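(* For $i=1,2$ let $\mathcal{X}_i$ be a real Banach space, $\mathcal{C}_i\subset\mathcal{X}_i$ a closed pointed convex normal cone with nonempty interior $\mathcal{C}_i^0$, and $\mathbf{e}_i\in\mathcal{C}_i^0$. Let $T:\mathcal{X}_1\to\mathcal{X}_2$ be a bounded linear map such that $T(\mathbf{e}_1)\in\mathbb{R}\mathbf{e}_2$. Then $$\|T\|_H=\|T^\star\|_H^\star=\frac12\sup_{\nu,\pi\in\mathcal{P}(\mathbf{e}_2)}\|T^\star(\nu)-T^\star(\pi)\|_T^\star=\sup_{\nu,\pi\in\mathcal{P}(\mathbf{e}_2)}\ \sup_{x\in[0,\mathbf{e}_1]}\langle\nu-\pi,T(x)\rangle.$$ Moreover, the suprema can be restricted to pairs of mutually disjoint extreme points: $$\|T\|_H=\|T^\star\|_H^\star=\frac12\sup_{\substack{\nu,\pi\in\operatorname{extr}\mathcal{P}(\mathbf{e}_2)\\ \nu\perp\pi}}\|T^\star(\nu)-T^\star(\pi)\|_T^\star=\sup_{\substack{\nu,\pi\in\operatorname{extr}\mathcal{P}(\mathbf{e}_2)\\ \nu\perp\pi}}\ \sup_{x\in[0,\mathbf{e}_1]}\langle\nu-\pi,T(x)\rangle.$$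
   Context: The following definitions apply to $(\mathcal{X},\mathcal{C},\mathbf{e})=(\mathcal{X}_i,\mathcal{C}_i,\mathbf{e}_i)$, $i=1,2$, with $\mathcal{X}_i\ne\{0\}$. $\mathcal{X}^\star$ is the dual space and $\langle q,x\rangle=q(x)$. Order: $x\preceq y\iff y-x\in\mathcal{C}$. Pointed: $\mathcal{C}\cap(-\mathcal{C})=\{0\}$. Normal: there is $K>0$ with $0\preceq x\preceq y\Rightarrow\|x\|\le K\|y\|$. $[x,y]=\{z:x\preceq z\preceq y\}$. $M(x/\mathbf{e})=\inf\{t\in\mathbb{R}:x\preceq t\mathbf{e}\}$, $m(x/\mathbf{e})=\sup\{t\in\mathbb{R}:x\succeq t\mathbf{e}\}$. Thompson's norm: $\|x\|_T=\max(M(x/\mathbf{e}),-m(x/\mathbf{e}))$, equivalent to the original norm; $\|\cdot\|_T^\star$ is its dual norm on $\mathcal{X}^\star$, $\|z\|_T^\star=\sup_{\|x\|_T=1}\langle z,x\rangle$. Hilbert's seminorm: $\|x\|_H=\omega(x/\mathbf{e})=M(x/\mathbf{e})-m(x/\mathbf{e})$; it induces a norm on the quotient $\mathcal{X}/\mathbb{R}\mathbf{e}$, whose dual is $\mathcal{M}(\mathbf{e})=\{\mu\in\mathcal{X}^\star:\langle\mu,\mathbf{e}\rangle=0\}$ with dual norm $\|\mu\|_H^\star=\frac12\|\mu\|_T^\star$. Dual cone: $\mathcal{C}^\star=\{z\in\mathcal{X}^\star:\langle z,x\rangle\ge0\ \forall x\in\mathcal{C}\}$, ordering $\mathcal{X}^\star$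 by $\mu\succeq\nu\iff\mu-\nu\in\mathcal{C}^\star$. $\mathcal{P}(\mathbf{e})=\{\mu\in\mathcal{C}^\star:\langle\mu,\mathbf{e}\rangle=1\}$. $\operatorname{extr}$ denotes extreme points. For $\nu,\pi\in\mathcal{P}(\mathbf{e})$, $\nu\perp\pi$ (disjoint) means that every $\mu\in\mathcal{P}(\mathbf{e})$ with $\mu\succeq\nu/2$ and $\mu\succeq\pi/2$ satisfies $\mu=(\nu+\pi)/2$. Since $T(\mathbf{e}_1)\in\mathbb{R}\mathbf{e}_2$, $T$ induces a map $\mathcal{X}_1/\mathbb{R}\mathbf{e}_1\to\mathcal{X}_2/\mathbb{R}\mathbf{e}_2$, and $\|T\|_H=\sup_{\|x\|_H=1}\|T(x)\|_H$ is its operator norm (the norms $\|\cdot\|_H$ in $\mathcal{X}_i$ being taken with respect to $\mathbf{e}_i$). $T^\star:\mathcal{X}_2^\star\to\mathcal{X}_1^\star$ is the adjoint; it maps $\mathcal{M}(\mathbf{e}_2)$ to $\mathcal{M}(\mathbf{e}_1)$, and $\|T^\star\|_H^\star=\sup\{\|T^\star(\mu)\|_H^\star:\mu\in\mathcal{M}(\mathbf{e}_2),\ \|\mu\|_H^\star\le1\}$. Convention: a supremum of nonnegative quantities over the empty set is $0$ (only relevant if $\dim\mathcal{X}_1=1$). *)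

theory Defs
  imports "HOL-Analysis.Analysis"
begin

definition cone_le :: "'a::real_vector set \<Rightarrow> 'a \<Rightarrow> 'a \<Rightarrow> bool" where
  "cone_le C x y \<longleftrightarrow> y - x \<in> C"

definition cone_interval :: "'a::real_vector set \<Rightarrow> 'a \<Rightarrow> 'a \<Rightarrow> 'a set" where
  "cone_interval C x y = {z. cone_le C x z \<and> cone_le C z y}"

definition pointed_cone :: "'a::real_vector set \<Rightarrow> bool" where
  "pointed_cone C \<longleftrightarrow> C \<inter> uminus ` C = {0}"

definition normal_cone :: "'a::real_normed_vector set \<Rightarrow> bool" where
  "normal_cone C \<longleftrightarrow>
     (\<exists>K>0. \<forall>x y. cone_le C 0 x \<and> cone_le C x y \<longrightarrow> norm x \<le> K * norm y)"

definition M_func :: "'a::real_vector set \<Rightarrow> 'a \<Rightarrow> 'a \<Rightarrow> real" where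
  "M_func C e x = Inf {t. cone_le C x (t *\<^sub>R e)}"

definition m_func :: "'a::real_vector set \<Rightarrow> 'a \<Rightarrow> 'a \<Rightarrow> real" where
  "m_func C e x = Sup {t. cone_le C (t *\<^sub>R e) x}"

definition thompson_norm :: "'a::real_vector set \<Rightarrow> 'a \<Rightarrow> 'a \<Rightarrow> real" where
  "thompson_norm C e x = max (M_func C e x) (- m_func C e x)"

definition hilbert_norm :: "'a::real_vector set \<Rightarrow> 'a \<Rightarrow> 'a \<Rightarrow> real" where
  "hilbert_norm C e x = M_func C e x - m_func C e x"

text \<open>
  Supremum of a set of nonnegative reals, with the convention that the supremum over
  the empty set is \<open>0\<close> (\<open>Sup {}\<close> is unspecified on \<^typ>\<open>real\<close>).
\<close>

definition nnSup :: "real set \<Rightarrow> real" where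
  "nnSup S = Sup (insert 0 S)"

text \<open>
  The dual of \<open>'a\<close> is \<open>'a \<Rightarrow>\<^sub>L real\<close>. It is ordered by \<open>cone_le (dual_cone C)\<close>.
\<close>

definition dual_cone :: "'a::real_normed_vector set \<Rightarrow> ('a \<Rightarrow>\<^sub>L real) set" where
  "dual_cone C = {z. \<forall>x\<in>C. 0 \<le> blinfun_apply z x}"

definition dual_thompson_norm :: "'a::real_normed_vector set \<Rightarrow> 'a \<Rightarrow> ('a \<Rightarrow>\<^sub>L real) \<Rightarrow> real" where
  "dual_thompson_norm C e z = Sup {blinfun_apply z x | x. thompson_norm C e x = 1}"

definition annihilator :: "'a::real_normed_vector \<Rightarrow> ('a \<Rightarrow>\<^sub>L real) set" where
  "annihilator e = {\<mu>. blinfun_apply \<mu> e = 0}"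

text \<open>
  The dual norm of the quotient norm that \<^const>\<open>hilbert_norm\<close> induces modulo the line
  spanned by \<open>e\<close>. It is meaningful on \<open>annihilator e\<close>, where the value at \<open>x\<close> depends
  only on the class of \<open>x\<close>. No \<open>x\<close> has Hilbert seminorm \<open>1\<close> if the space is a line.
\<close>

definition dual_hilbert_norm :: "'a::real_normed_vector set \<Rightarrow> 'a \<Rightarrow> ('a \<Rightarrow>\<^sub>L real) \<Rightarrow> real" where
  "dual_hilbert_norm C e \<mu> = nnSup {\<bar>blinfun_apply \<mu> x\<bar> | x. hilbert_norm C e x = 1}"

definition states :: "'a::real_normed_vector set \<Rightarrow> 'a \<Rightarrow> ('a \<Rightarrow>\<^sub>L real) set" where
  "states C e = {\<mu> \<in> dual_cone C. blinfun_apply \<mu> e = 1}"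

definition disjoint_states ::
  "'a::real_normed_vector set \<Rightarrow> 'a \<Rightarrow> ('a \<Rightarrow>\<^sub>L real) \<Rightarrow> ('a \<Rightarrow>\<^sub>L real) \<Rightarrow> bool" where
  "disjoint_states C e \<nu> \<pi> \<longleftrightarrow>
     (\<forall>\<mu>\<in>states C e.
        cone_le (dual_cone C) ((1/2) *\<^sub>R \<nu>) \<mu> \<and> cone_le (dual_cone C) ((1/2) *\<^sub>R \<pi>) \<mu>
        \<longrightarrow> \<mu> = (1/2) *\<^sub>R (\<nu> + \<pi>))"

definition adjoint_blinfun ::
  "('a::real_normed_vector \<Rightarrow>\<^sub>L 'b::real_normed_vector) \<Rightarrow> ('b \<Rightarrow>\<^sub>L real) \<Rightarrow> ('a \<Rightarrow>\<^sub>L real)" where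
  "adjoint_blinfun T q = q o\<^sub>L T"

definition hilbert_op_norm ::
  "'a::real_normed_vector set \<Rightarrow> 'a \<Rightarrow> 'b::real_normed_vector set \<Rightarrow> 'b \<Rightarrow> ('a \<Rightarrow>\<^sub>L 'b) \<Rightarrow> real" where
  "hilbert_op_norm C\<^sub>1 e\<^sub>1 C\<^sub>2 e\<^sub>2 T =
     nnSup {hilbert_norm C\<^sub>2 e\<^sub>2 (blinfun_apply T x) | x. hilbert_norm C\<^sub>1 e\<^sub>1 x = 1}"

text \<open>The argument \<open>S\<close> is a map between the duals, such as \<open>adjoint_blinfun T\<close>.\<close>

definition dual_hilbert_op_norm ::
  "'a::real_normed_vector set \<Rightarrow> 'a \<Rightarrow> 'b::real_normed_vector set \<Rightarrow> 'b \<Rightarrow>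
     (('b \<Rightarrow>\<^sub>L real) \<Rightarrow> ('a \<Rightarrow>\<^sub>L real)) \<Rightarrow> real" where
  "dual_hilbert_op_norm C\<^sub>1 e\<^sub>1 C\<^sub>2 e\<^sub>2 S =
     nnSup {dual_hilbert_norm C\<^sub>1 e\<^sub>1 (S \<mu>) | \<mu>.
              \<mu> \<in> annihilator e\<^sub>2 \<and> dual_hilbert_norm C\<^sub>2 e\<^sub>2 \<mu> \<le> 1}"

end

theory Submission
  imports Defs
begin

text \<open>
  Write \<open>M\<close> for \<open>M(\<cdot>/e)\<close> and \<open>H\<close> for Hilbert's seminorm, so that \<open>H x = M x + M (- x)\<close>.
  Both are sublinear; the states are the linear functionals below \<open>M\<close>, and the dual unit
  ball of \<open>H\<close> consists of the linear functionals below \<open>H\<close>.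

  On the primal side, every vector of Hilbert seminorm one lies in \<open>[0, e]\<close> up to a
  multiple of \<open>e\<close>, which functionals in \<open>\<M>(e)\<close> do not see. Hence on \<open>\<M>(e)\<close> the dual
  Hilbert norm and half the dual Thompson norm both equal the supremum over \<open>[0, e]\<close>
  (\<open>dual_hilbert_norm_eq_interval_sup\<close>, \<open>dual_thompson_norm_eq_interval_sup\<close>), and for
  each family of pairs the two displayed suprema agree term by term.

  On the dual side, \<open>H y\<close> is attained at an extreme point of the dual ball
  (\<open>extreme_linear_functional_attaining\<close>). That point is a difference \<open>\<nu> - \<pi>\<close> of states
  (\<open>linear_functional_below_sum\<close>), and extremality of the difference makes \<open>\<nu>\<close> and \<open>\<pi>\<close>
  extreme and disjoint (\<open>hilbert_norm_attained_at_disjoint_extreme_states\<close>). Thus the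
  supremum over disjoint extreme pairs is already at least \<open>\<parallel>T\<parallel>\<^sub>H\<close>. The remaining
  inequalities close the circle: this supremum is at most the one over all pairs of
  states, which is at most \<open>\<parallel>T\<^sup>\<star>\<parallel>\<^sub>H\<^sup>\<star>\<close> because differences of states lie in the dual ball,
  and that is at most \<open>\<parallel>T\<parallel>\<^sub>H\<close> by duality.

  The Hahn-Banach and Krein-Milman theorems enter through one application of Zorn's lemma
  to sublinear functionals. A sublinear \<open>q\<close> stands for the convex set of linear functionals
  below it; faces of the dual ball become certain \<open>q\<close>, and a minimal face is a linear \<open>q\<close>.
\<close>

section \<open>Sublinear functionals\<close>

definition sublinear :: "('a::real_vector \<Rightarrow> real) \<Rightarrow> bool" where
  "sublinear p \<longleftrightarrow>
     (\<forall>x y. p (x + y) \<le> p x + p y) \<and> (\<forall>a\<ge>0. \<forall>x. p (a *\<^sub>R x) = a * p x)"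

lemma sublinear_add: "sublinear p \<Longrightarrow> p (x + y) \<le> p x + p y"
  by (simp add: sublinear_def)

lemma sublinear_scale: "sublinear p \<Longrightarrow> 0 \<le> a \<Longrightarrow> p (a *\<^sub>R x) = a * p x"
  by (simp add: sublinear_def)

lemma sublinear_zero: "sublinear p \<Longrightarrow> p 0 = 0"
  using sublinear_scale[of p 0 0] by simp

lemma sublinear_neg: "sublinear p \<Longrightarrow> - p (- x) \<le> p x"
  using sublinear_add[of p x "- x"] sublinear_zero[of p] by simp

text \<open>
  One inequality suffices for homogeneity: the other is the same inequality for
  the inverse factor.
\<close>

lemma sublinearI:
  assumes add: "\<And>x y. p (x + y) \<le> p x + p y"
    and scale: "\<And>a x. 0 < a \<Longrightarrow> p (a *\<^sub>R x) \<le> a * p x"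
    and zero: "p 0 = 0"
  shows "sublinear p"
  unfolding sublinear_def
proof (intro conjI allI impI)
  fix a :: real and x
  assume "0 \<le> a"
  show "p (a *\<^sub>R x) = a * p x"
  proof (cases "a = 0")
    case False
    with \<open>0 \<le> a\<close> have a: "0 < a" by simp
    have "p (inverse a *\<^sub>R (a *\<^sub>R x)) \<le> inverse a * p (a *\<^sub>R x)"
      using a by (intro scale) simp
    then have "a * p x \<le> p (a *\<^sub>R x)"
      using a by (simp add: field_simps)
    with scale[OF a, of x] show ?thesis by simp
  qed (simp add: zero)
qed (rule add)

lemma sublinear_sum:
  assumes "sublinear p" "sublinear r"
  shows "sublinear (\<lambda>x. p x + r x)"
  using assms unfolding sublinear_def by (auto simp: algebra_simps) (smt (verit))

lemma sublinear_reflect: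
  assumes "sublinear p"
  shows "sublinear (\<lambda>x. p (- x))"
  using assms unfolding sublinear_def by (metis minus_add_distrib scaleR_minus_right)

text \<open>
  Partial minimization of a jointly sublinear function over a convex cone. Both
  constructions below, tightening a functional along a vector and the infimal
  convolution, are of this form.
\<close>

lemma sublinear_partial_INF:
  fixes G :: "'a::real_vector \<Rightarrow> 'b::real_vector \<Rightarrow> real"
  assumes K0: "0 \<in> K"
    and Kadd: "\<And>k l. k \<in> K \<Longrightarrow> l \<in> K \<Longrightarrow> k + l \<in> K"
    and Kscale: "\<And>a k. 0 < a \<Longrightarrow> k \<in> K \<Longrightarrow> a *\<^sub>R k \<in> K"
    and Gadd: "\<And>x y k l. k \<in> K \<Longrightarrow> l \<in> K \<Longrightarrow> G (x + y) (k + l) \<le> G x k + G y l"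
    and Gscale: "\<And>a x k. 0 < a \<Longrightarrow> k \<in> K \<Longrightarrow> G (a *\<^sub>R x) (a *\<^sub>R k) \<le> a * G x k"
    and G0: "G 0 0 = 0" "\<And>k. k \<in> K \<Longrightarrow> 0 \<le> G 0 k"
    and lower: "\<And>x k. k \<in> K \<Longrightarrow> b x \<le> G x k"
  shows "sublinear (\<lambda>x. INF k\<in>K. G x k)"
proof (rule sublinearI)
  have bdd: "bdd_below (G x ` K)" for x
    using lower by (intro bdd_belowI[of _ "b x"]) auto
  have ne: "K \<noteq> {}"
    using K0 by auto
  have le: "(INF k\<in>K. G x k) \<le> G x k" if "k \<in> K" for x k
    using bdd that by (rule cINF_lower)
  show "(INF k\<in>K. G (x + y) k) \<le> (INF k\<in>K. G x k) + (INF k\<in>K. G y k)" for x y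
  proof -
    have "(INF k\<in>K. G (x + y) k) - G y l \<le> (INF k\<in>K. G x k)" if "l \<in> K" for l
      using Gadd[OF _ that] le[OF Kadd[OF _ that]] by (intro cINF_greatest ne) (smt (verit))
    then have "(INF k\<in>K. G (x + y) k) - (INF k\<in>K. G x k) \<le> (INF k\<in>K. G y k)"
      by (intro cINF_greatest ne) (smt (verit))
    then show ?thesis by simp
  qed
  show "(INF k\<in>K. G (a *\<^sub>R x) k) \<le> a * (INF k\<in>K. G x k)" if a: "0 < a" for a x
  proof -
    have "(INF k\<in>K. G (a *\<^sub>R x) k) / a \<le> G x k" if "k \<in> K" for k
      using le[OF Kscale[OF a that], of "a *\<^sub>R x"] Gscale[OF a that, of x] a
      by (simp add: field_simps)
    then have "(INF k\<in>K. G (a *\<^sub>R x) k) / a \<le> (INF k\<in>K. G x k)"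
      by (intro cINF_greatest ne)
    then show ?thesis using a by (simp add: field_simps)
  qed
  show "(INF k\<in>K. G 0 k) = 0"
    using le[OF K0, of 0] G0 by (intro antisym cINF_greatest ne) auto
qed

text \<open>
  The largest sublinear functional below \<open>p\<close> with value \<open>- p y\<close> at \<open>- y\<close>. A linear
  functional below \<open>p\<close> lies below it exactly if it agrees with \<open>p\<close> at \<open>y\<close>.
\<close>

definition tighten :: "('a::real_vector \<Rightarrow> real) \<Rightarrow> 'a \<Rightarrow> 'a \<Rightarrow> real" where
  "tighten p y x = (INF t\<in>{0..}. p (x + t *\<^sub>R y) - t * p y)"

lemma tighten_lower:
  assumes p: "sublinear p" and "0 \<le> t"
  shows "- p (- x) \<le> p (x + t *\<^sub>R y) - t * p y"
  using sublinear_add[OF p, of "x + t *\<^sub>R y" "- x"] sublinear_scale[OF assms, of y] by simp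

lemma tighten_le:
  assumes "sublinear p" "0 \<le> t"
  shows "tighten p y x \<le> p (x + t *\<^sub>R y) - t * p y"
  unfolding tighten_def using tighten_lower[OF assms(1)] assms(2)
  by (intro cINF_lower bdd_belowI[of _ "- p (- x)"]) auto

lemma sublinear_tighten:
  assumes p: "sublinear p"
  shows "sublinear (tighten p y)"
  unfolding tighten_def[abs_def]
proof (rule sublinear_partial_INF[where b = "\<lambda>x. - p (- x)"])
  fix s t :: real and x z :: 'a
  assume "s \<in> {0..}" "t \<in> {0..}"
  show "p (x + z + (s + t) *\<^sub>R y) - (s + t) * p y
        \<le> p (x + s *\<^sub>R y) - s * p y + (p (z + t *\<^sub>R y) - t * p y)"
    using sublinear_add[OF p, of "x + s *\<^sub>R y" "z + t *\<^sub>R y"] by (simp add: algebra_simps)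
next
  fix a t :: real and x :: 'a
  assume "0 < a"
  then show "p (a *\<^sub>R x + (a *\<^sub>R t) *\<^sub>R y) - a *\<^sub>R t * p y \<le> a * (p (x + t *\<^sub>R y) - t * p y)"
    using sublinear_scale[OF p, of a "x + t *\<^sub>R y"] by (simp add: algebra_simps)
qed (use tighten_lower[OF p] sublinear_zero[OF p] sublinear_scale[OF p] in auto)

section \<open>Extreme linear functionals below a sublinear functional\<close>

text \<open>
  Those sublinear \<open>q\<close> below \<open>p\<close> for which the linear functionals below \<open>q\<close> form a
  face of the convex set of linear functionals below \<open>p\<close>. The functional \<open>q\<close> encodes
  this face, so that shrinking a face amounts to decreasing \<open>q\<close>.
\<close>

definition facial :: "('a::real_vector \<Rightarrow> real) \<Rightarrow> ('a \<Rightarrow> real) \<Rightarrow> bool" where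
  "facial p q \<longleftrightarrow> sublinear q \<and> q \<le> p \<and>
     (\<forall>f g u. linear f \<and> linear g \<and> f \<le> p \<and> g \<le> p \<and> 0 < u \<and> u < 1
        \<and> (\<lambda>x. (1 - u) * f x + u * g x) \<le> q \<longrightarrow> f \<le> q \<and> g \<le> q)"

lemma facial_tighten:
  assumes "facial p q"
  shows "facial p (tighten q y)"
proof -
  have q: "sublinear q" "q \<le> p"
    using assms by (auto simp: facial_def)
  have le: "tighten q y x \<le> q x" for x
    using tighten_le[OF q(1), of 0 y x] by simp
  then have tq: "tighten q y \<le> q"
    by (rule le_funI)
  have below: "f \<le> tighten q y" if f: "linear f" "f \<le> q" "f y = q y" for f
  proof (rule le_funI)
    fix x
    have "f x \<le> q (x + t *\<^sub>R y) - t * q y" for t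
      using le_funD[OF f(2), of "x + t *\<^sub>R y"] f(3)
      by (simp add: linear_add[OF f(1)] linear_scale[OF f(1)])
    then show "f x \<le> tighten q y x"
      unfolding tighten_def by (intro cINF_greatest) auto
  qed
  show ?thesis
    unfolding facial_def
  proof (intro conjI allI impI)
    show "sublinear (tighten q y)"
      by (rule sublinear_tighten) (rule q(1))
    show "tighten q y \<le> p"
      using tq q(2) by (rule order_trans)
    fix f g u
    assume "linear f \<and> linear g \<and> f \<le> p \<and> g \<le> p \<and> 0 < u \<and> u < 1
        \<and> (\<lambda>x. (1 - u) * f x + u * g x) \<le> tighten q y"
    then have fg: "linear f" "linear g" "f \<le> p" "g \<le> p" and u: "0 < u" "u < 1"
      and comb: "(\<lambda>x. (1 - u) * f x + u * g x) \<le> tighten q y"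
      by blast+
    have "(\<lambda>x. (1 - u) * f x + u * g x) \<le> q"
      using comb tq by (rule order_trans)
    with assms fg u have fgq: "f \<le> q" "g \<le> q"
      unfolding facial_def by blast+
    have "(1 - u) * f (- y) + u * g (- y) \<le> - q y"
      using le_funD[OF comb, of "- y"] tighten_le[OF q(1), of 1 y "- y"] sublinear_zero[OF q(1)] by simp
    then have "(1 - u) * (q y - f y) + u * (q y - g y) \<le> 0"
      by (simp add: linear_neg fg algebra_simps)
    moreover have "0 \<le> (1 - u) * (q y - f y)" "0 \<le> u * (q y - g y)"
      using u le_funD[OF fgq(1), of y] le_funD[OF fgq(2), of y] by auto
    ultimately have "(1 - u) * (q y - f y) = 0" "u * (q y - g y) = 0"
      by linarith+
    with u have "f y = q y" "g y = q y"
      by auto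
    then show "f \<le> tighten q y" "g \<le> tighten q y"
      using below fg fgq by auto
  qed
qed

lemma facial_chain_INF:
  assumes ne: "F \<noteq> {}" and facial: "\<And>q. q \<in> F \<Longrightarrow> facial p q"
    and chain: "\<And>q r. q \<in> F \<Longrightarrow> r \<in> F \<Longrightarrow> q \<le> r \<or> r \<le> q"
  shows "facial p (\<lambda>x. INF q\<in>F. q x)"
proof -
  have sub: "sublinear q" "q \<le> p" if "q \<in> F" for q
    using facial[OF that] by (auto simp: facial_def)
  have "- p (- x) \<le> q x" if "q \<in> F" for q x
    using sublinear_neg[OF sub(1)[OF that], of x] le_funD[OF sub(2)[OF that], of "- x"] by simp
  then have bdd: "bdd_below ((\<lambda>q. q x) ` F)" for x
    by (intro bdd_belowI[of _ "- p (- x)"]) auto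
  have le: "(INF q\<in>F. q x) \<le> q x" if "q \<in> F" for q x
    using cINF_lower[OF bdd that] .
  then have lef: "(\<lambda>x. INF q\<in>F. q x) \<le> q" if "q \<in> F" for q
    using that by (intro le_funI)
  have "sublinear (\<lambda>x. INF q\<in>F. q x)"
  proof (rule sublinearI)
    fix x y
    have pair: "(INF q\<in>F. q (x + y)) \<le> q x + r y" if "q \<in> F" "r \<in> F" for q r
    proof -
      \<comment> \<open>The smaller of two members of the chain bounds both summands at once.\<close>
      obtain s where s: "s \<in> F" "s \<le> q" "s \<le> r"
        using chain[of q r] \<open>q \<in> F\<close> \<open>r \<in> F\<close> by auto
      show ?thesis
        using le[OF s(1), of "x + y"] sublinear_add[OF sub(1)[OF s(1)], of x y]
          le_funD[OF s(2), of x] le_funD[OF s(3), of y] by linarith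
    qed
    have "(INF q\<in>F. q (x + y)) - r y \<le> (INF q\<in>F. q x)" if "r \<in> F" for r
      using pair[OF _ that] by (intro cINF_greatest ne) (simp add: algebra_simps)
    then have "(INF q\<in>F. q (x + y)) - (INF q\<in>F. q x) \<le> (INF r\<in>F. r y)"
      by (intro cINF_greatest ne) (simp add: algebra_simps)
    then show "(INF q\<in>F. q (x + y)) \<le> (INF q\<in>F. q x) + (INF q\<in>F. q y)"
      by simp
  next
    fix a :: real and x
    assume a: "0 < a"
    have "(INF q\<in>F. q (a *\<^sub>R x)) / a \<le> q x" if "q \<in> F" for q
      using le[OF that, of "a *\<^sub>R x"] sublinear_scale[OF sub(1)[OF that], of a x] a
      by (simp add: field_simps)
    then have "(INF q\<in>F. q (a *\<^sub>R x)) / a \<le> (INF q\<in>F. q x)"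
      by (intro cINF_greatest ne)
    then show "(INF q\<in>F. q (a *\<^sub>R x)) \<le> a * (INF q\<in>F. q x)"
      using a by (simp add: field_simps)
  next
    show "(INF q\<in>F. q 0) = 0"
      using sub(1) ne by (simp add: sublinear_zero)
  qed
  moreover have "(\<lambda>x. INF q\<in>F. q x) \<le> p"
    using ne lef sub(2) order_trans by blast
  moreover have "f \<le> (\<lambda>x. INF q\<in>F. q x) \<and> g \<le> (\<lambda>x. INF q\<in>F. q x)"
    if fg: "linear f \<and> linear g \<and> f \<le> p \<and> g \<le> p \<and> 0 < u \<and> u < 1
        \<and> (\<lambda>x. (1 - u) * f x + u * g x) \<le> (\<lambda>x. INF q\<in>F. q x)" for f g u
  proof -
    have "f \<le> q \<and> g \<le> q" if q: "q \<in> F" for q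
    proof -
      have "(\<lambda>x. (1 - u) * f x + u * g x) \<le> q"
        using fg lef[OF q] order_trans by blast
      then show ?thesis
        using facial[OF q] fg unfolding facial_def by blast
    qed
    then show ?thesis
      by (auto simp: le_fun_def intro!: cINF_greatest ne)
  qed
  ultimately show ?thesis
    unfolding facial_def by blast
qed

text \<open>
  Hahn-Banach and Krein-Milman in one step. A minimal face-encoding functional \<open>q\<close> below
  \<open>tighten p y\<close> is fixed by tightening along every vector, hence odd, hence linear; then
  the face is the single point \<open>q\<close>. Working with sublinear functionals in place of faces
  makes the infimum of a chain available without any compactness.
\<close>

theorem extreme_linear_functional_attaining:
  fixes p :: "'a::real_vector \<Rightarrow> real"
  assumes p: "sublinear p"
  obtains f where "linear f" "f \<le> p" "f y = p y"
    "\<And>g h u. linear g \<Longrightarrow> linear h \<Longrightarrow> g \<le> p \<Longrightarrow> h \<le> p \<Longrightarrow> 0 < u \<Longrightarrow> u < 1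
       \<Longrightarrow> (\<And>x. f x = (1 - u) * g x + u * h x) \<Longrightarrow> g = f \<and> h = f"
proof -
  define Q where "Q = {q. facial p q \<and> q \<le> tighten p y}"
  have "facial p p"
    using p unfolding facial_def by blast
  then have start: "tighten p y \<in> Q"
    by (simp add: Q_def facial_tighten)
  have "\<exists>m\<in>Q. \<forall>q\<in>Q. q \<le> m \<longrightarrow> q = m"
  proof (rule predicate_Zorn[where P = "\<lambda>q r. r \<le> q"])
    show "partial_order_on Q (relation_of (\<lambda>q r. r \<le> q) Q)"
      by (rule partial_order_on_relation_ofI) auto
  next
    fix F
    assume F: "F \<in> Chains (relation_of (\<lambda>q r. r \<le> q) Q)"
    have FQ: "F \<subseteq> Q"
      using F by (rule Chains_relation_of)
    have chain: "q \<le> r \<or> r \<le> q" if "q \<in> F" "r \<in> F" for q r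
      using F that unfolding Chains_def relation_of_def by auto
    show "\<exists>l\<in>Q. \<forall>q\<in>F. l \<le> q"
    proof (cases "F = {}")
      case False
      have facial: "facial p q" if "q \<in> F" for q
        using FQ that by (auto simp: Q_def)
      have lower: "(\<lambda>x. INF q\<in>F. q x) \<le> q" if q: "q \<in> F" for q
      proof (rule le_funI, rule cINF_lower[OF _ q])
        fix x
        have "- p (- x) \<le> r x" if "r \<in> F" for r
          using facial[OF that] sublinear_neg[of r x]
          unfolding facial_def le_fun_def by (smt (verit))
        then show "bdd_below ((\<lambda>q. q x) ` F)"
          by (intro bdd_belowI[of _ "- p (- x)"]) auto
      qed
      obtain q where "q \<in> F" using False by blast
      then have "(\<lambda>x. INF q\<in>F. q x) \<le> tighten p y"
        using lower FQ by (auto simp: Q_def intro: order_trans)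
      then have "(\<lambda>x. INF q\<in>F. q x) \<in> Q"
        using facial_chain_INF[OF False facial chain] by (simp add: Q_def)
      with lower show ?thesis by blast
    qed (use start in auto)
  qed
  then obtain f where f: "f \<in> Q" and min: "\<And>q. q \<in> Q \<Longrightarrow> q \<le> f \<Longrightarrow> q = f"
    by blast
  have facial: "facial p f" and ft: "f \<le> tighten p y"
    using f by (simp_all add: Q_def)
  then have fsub: "sublinear f" and fp: "f \<le> p"
    unfolding facial_def by blast+
  have odd: "f (- z) = - f z" for z
  proof -
    have le: "tighten f z \<le> f"
      using tighten_le[OF fsub, of 0 z] by (simp add: le_fun_def)
    then have "tighten f z \<in> Q"
      using facial_tighten[OF facial] ft by (auto simp: Q_def)
    with le have "tighten f z = f"
      by (simp add: min)
    then have "f (- z) \<le> - f z"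
      using tighten_le[OF fsub, of 1 z "- z"] sublinear_zero[OF fsub] by simp
    with sublinear_neg[OF fsub, of z] show ?thesis by simp
  qed
  have lin: "linear f"
  proof (rule linearI)
    show "f (x + z) = f x + f z" for x z
      using sublinear_add[OF fsub, of x z] sublinear_add[OF fsub, of "- x" "- z"]
        odd[of x] odd[of z] odd[of "x + z"] by simp
    show "f (a *\<^sub>R x) = a *\<^sub>R f x" for a x
      using sublinear_scale[OF fsub, of a x] sublinear_scale[OF fsub, of "- a" x]
        odd[of "a *\<^sub>R x"] by (cases "0 \<le> a") auto
  qed
  have unique: "g = f" if g: "linear g" "g \<le> f" for g
  proof
    show "g x = f x" for x
      using le_funD[OF g(2), of x] le_funD[OF g(2), of "- x"]
      by (simp add: linear_neg g lin)
  qed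
  have attains: "f y = p y"
    using le_funD[OF ft, of "- y"] tighten_le[OF p, of 1 y "- y"] le_funD[OF fp, of y]
      sublinear_zero[OF p] odd[of y] by simp
  have extreme: "g = f \<and> h = f"
    if "linear g" "linear h" "g \<le> p" "h \<le> p" "0 < u" "u < 1"
      "\<And>x. f x = (1 - u) * g x + u * h x" for g h u
  proof -
    have "(\<lambda>x. (1 - u) * g x + u * h x) \<le> f"
      using that(7) by (simp add: le_fun_def)
    then have "g \<le> f \<and> h \<le> f"
      using facial that(1-6) unfolding facial_def by blast
    with unique that(1,2) show ?thesis by blast
  qed
  show thesis
    using that[OF lin fp attains extreme] .
qed

text \<open>
  A linear functional below a sum splits into summands below the two terms: a summand
  \<open>g\<close> is suitable exactly if it lies below \<open>p\<close> and below \<open>z \<mapsto> r (- z) + f z\<close>, that is,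
  below the infimal convolution of these two sublinear functionals.
\<close>

lemma linear_functional_below_sum:
  fixes f p r :: "'a::real_vector \<Rightarrow> real"
  assumes p: "sublinear p" and r: "sublinear r" and f: "linear f"
    and le: "\<And>x. f x \<le> p x + r x"
  obtains g h where "linear g" "linear h" "g \<le> p" "h \<le> r" "\<And>x. f x = g x + h x"
proof -
  define G where "G x z = p (x - z) + (r (- z) + f z)" for x z
  have lower: "- p (- x) \<le> G x z" for x z
    using le[of "- z"] sublinear_add[OF p, of "x - z" "- x"]
    by (simp add: G_def linear_neg f)
  have bdd: "bdd_below (range (G x))" for x
    using lower by (intro bdd_belowI[of _ "- p (- x)"]) auto
  have "sublinear (\<lambda>x. INF z. G x z)"
  proof (rule sublinear_partial_INF[where b = "\<lambda>x. - p (- x)"])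
    show "G (x + y) (z + w) \<le> G x z + G y w" for x y z w
      using sublinear_add[OF p, of "x - z" "y - w"] sublinear_add[OF r, of "- z" "- w"]
      by (simp add: G_def linear_add f algebra_simps)
    show "G (a *\<^sub>R x) (a *\<^sub>R z) \<le> a * G x z" if "0 < a" for a x z
      using sublinear_scale[OF p, of a "x - z"] sublinear_scale[OF r, of a "- z"] that
      by (simp add: G_def linear_scale f algebra_simps)
    show "0 \<le> G 0 z" for z
      using lower[of 0 z] sublinear_zero[OF p] by simp
      show "G 0 0 = 0"
      by (simp add: G_def sublinear_zero p r linear_0 f)
  qed (simp_all add: lower)
  then obtain g where g: "linear g" "g \<le> (\<lambda>x. INF z. G x z)"
    by (rule extreme_linear_functional_attaining) blast
  have gG: "g x \<le> G x z" for x z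
    using le_funD[OF g(2), of x] cINF_lower[OF bdd, of z x] by simp
  show thesis
  proof (rule that[of g "\<lambda>x. f x - g x"])
    show "linear (\<lambda>x. f x - g x)"
      using f g(1) by (rule linear_compose_sub)
    show "g \<le> p"
      using gG[of _ 0] by (auto simp: G_def le_fun_def sublinear_zero r linear_0 f)
    show "(\<lambda>x. f x - g x) \<le> r"
    proof (rule le_funI)
      show "f x - g x \<le> r x" for x
        using gG[of "- x" "- x"] sublinear_zero[OF p] by (simp add: G_def linear_neg f g)
    qed
  qed (auto simp: g)
qed

section \<open>Suprema with zero adjoined\<close>

lemma nnSup_least:
  assumes "\<And>x. x \<in> S \<Longrightarrow> x \<le> b" "0 \<le> b"
  shows "nnSup S \<le> b"
  unfolding nnSup_def using assms by (intro cSup_least) auto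

lemma nnSup_upper:
  assumes "x \<in> S" "\<And>x. x \<in> S \<Longrightarrow> x \<le> b"
  shows "x \<le> nnSup S"
  unfolding nnSup_def using assms by (intro cSup_upper bdd_aboveI[of _ "max 0 b"]) fastforce+

lemma nnSup_nonneg:
  assumes "\<And>x. x \<in> S \<Longrightarrow> x \<le> b"
  shows "0 \<le> nnSup S"
  unfolding nnSup_def using assms by (intro cSup_upper bdd_aboveI[of _ "max 0 b"]) fastforce+

lemma nnSup_scale:
  assumes a: "0 < a" and bdd: "\<And>x. x \<in> S \<Longrightarrow> x \<le> b"
  shows "nnSup ((\<lambda>x. a * x) ` S) = a * nnSup S"
proof (rule antisym)
  show "nnSup ((\<lambda>x. a * x) ` S) \<le> a * nnSup S"
    using nnSup_upper[of _ S b] nnSup_nonneg[of S b] bdd a by (intro nnSup_least) auto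
  have up: "z \<le> a * b" if "z \<in> (\<lambda>x. a * x) ` S" for z
    using bdd a that by auto
  have "nnSup S \<le> nnSup ((\<lambda>x. a * x) ` S) / a"
  proof (rule nnSup_least)
    show "x \<le> nnSup ((\<lambda>x. a * x) ` S) / a" if "x \<in> S" for x
      using nnSup_upper[of "a * x" "(\<lambda>x. a * x) ` S" "a * b", OF _ up] a that
      by (simp add: field_simps)
    show "0 \<le> nnSup ((\<lambda>x. a * x) ` S) / a"
      using nnSup_nonneg[of "(\<lambda>x. a * x) ` S" "a * b", OF up] a by simp
  qed
  then show "a * nnSup S \<le> nnSup ((\<lambda>x. a * x) ` S)"
    using a by (simp add: field_simps)
qed

section \<open>Spaces ordered by a normal cone with an order unit\<close>

locale order_unit_cone =
  fixes C :: "'a::real_normed_vector set" and e :: 'a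
  assumes nontrivial: "(UNIV :: 'a set) \<noteq> {0}"
    and cone: "convex_cone C" and closed: "closed C"
    and pointed: "pointed_cone C" and normal: "normal_cone C"
    and unit: "e \<in> interior C"
begin

abbreviation M :: "'a \<Rightarrow> real" where "M \<equiv> M_func C e"

abbreviation H :: "'a \<Rightarrow> real" where "H \<equiv> hilbert_norm C e"

lemma eq_zero_if_both_signs: "x \<in> C \<Longrightarrow> - x \<in> C \<Longrightarrow> x = 0"
  using pointed unfolding pointed_cone_def by (metis IntI image_eqI minus_minus singletonD)

lemma dominated_by_unit:
  obtains c where "0 < c" "\<And>x. (c * norm x) *\<^sub>R e - x \<in> C"
proof -
  obtain r where r: "0 < r" "cball e r \<subseteq> C"
    using unit unfolding mem_interior_cball by blast
  have "(inverse r * norm x) *\<^sub>R e - x \<in> C" for x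
  proof (cases "x = 0")
    case True
    then show ?thesis using convex_cone_contains_0[OF cone] by simp
  next
    case False
    then have "e - (r / norm x) *\<^sub>R x \<in> C"
      using r by (intro subsetD[OF r(2)]) (simp add: dist_norm)
    then have "(norm x / r) *\<^sub>R (e - (r / norm x) *\<^sub>R x) \<in> C"
      using r by (intro convex_cone_scaleR[OF cone]) auto
    then show ?thesis
      using False r by (simp add: algebra_simps divide_inverse)
  qed
  with r show thesis by (intro that[of "inverse r"]) auto
qed

lemma minus_unit_notin: "- e \<notin> C"
proof
  assume "- e \<in> C"
  then have "e = 0"
    using unit interior_subset eq_zero_if_both_signs by blast
  obtain c where c: "\<And>x. (c * norm x) *\<^sub>R e - x \<in> C"
    using dominated_by_unit by blast
  \<comment> \<open>With \<open>e = 0\<close> in its interior, the cone is the whole space.\<close>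
  have "x = 0" for x :: 'a
    using c[of x] c[of "- x"] \<open>e = 0\<close> by (intro eq_zero_if_both_signs) auto
  with nontrivial show False by auto
qed

lemma unit_multiple_mem_iff: "t *\<^sub>R e \<in> C \<longleftrightarrow> 0 \<le> t"
proof
  assume t: "t *\<^sub>R e \<in> C"
  show "0 \<le> t"
  proof (rule ccontr)
    assume "\<not> 0 \<le> t"
    then have "inverse (- t) *\<^sub>R (t *\<^sub>R e) \<in> C"
      using t by (intro convex_cone_scaleR[OF cone _ t]) auto
    with \<open>\<not> 0 \<le> t\<close> minus_unit_notin show False by simp
  qed
next
  assume "0 \<le> t"
  then show "t *\<^sub>R e \<in> C"
    using unit interior_subset by (intro convex_cone_scaleR[OF cone]) auto
qed

text \<open>Closedness of the cone makes the infimum that defines \<open>M\<close> a minimum.\<close>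

lemma M_le_iff: "M x \<le> t \<longleftrightarrow> t *\<^sub>R e - x \<in> C"
proof -
  define S where "S = {t. t *\<^sub>R e - x \<in> C}"
  obtain c where c: "\<And>x. (c * norm x) *\<^sub>R e - x \<in> C"
    using dominated_by_unit by blast
  have M: "M x = Inf S"
    by (simp add: M_func_def cone_le_def S_def)
  have "c * norm x \<in> S"
    using c by (simp add: S_def)
  moreover have lower: "- (c * norm x) \<le> s" if "s \<in> S" for s
  proof -
    have "(s *\<^sub>R e - x) + ((c * norm (- x)) *\<^sub>R e - (- x)) \<in> C"
      using that c[of "- x"] by (intro convex_cone_add[OF cone]) (auto simp: S_def)
    then have "(s + c * norm x) *\<^sub>R e \<in> C"
      by (simp add: algebra_simps)
    then show ?thesis by (simp add: unit_multiple_mem_iff)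
  qed
  then have bdd: "bdd_below S"
    by (intro bdd_belowI)
  moreover have "S = (\<lambda>t. t *\<^sub>R e - x) -` C"
    by (auto simp: S_def)
  then have "closed S"
    using closed by (simp add: closed_vimage continuous_on_diff continuous_on_scaleR)
  ultimately have "Inf S \<in> S"
    using closed_contains_Inf by blast
  then have min: "M x *\<^sub>R e - x \<in> C"
    by (simp add: M S_def)
  show ?thesis
  proof
    assume "M x \<le> t"
    then have "(M x *\<^sub>R e - x) + (t - M x) *\<^sub>R e \<in> C"
      using min by (intro convex_cone_add[OF cone]) (simp_all add: unit_multiple_mem_iff)
    then show "t *\<^sub>R e - x \<in> C" by (simp add: algebra_simps)
  next
    assume "t *\<^sub>R e - x \<in> C"
    then show "M x \<le> t"
      unfolding M using bdd by (intro cInf_lower) (simp_all add: S_def)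
  qed
qed

lemma m_eq: "m_func C e x = - M (- x)"
proof -
  have "{t. cone_le C (t *\<^sub>R e) x} = uminus ` {t. cone_le C (- x) (t *\<^sub>R e)}"
    by (auto simp: cone_le_def image_iff algebra_simps intro!: exI[of _ "- _"])
  then show ?thesis
    by (simp add: m_func_def M_func_def Inf_real_def)
qed

lemma hilbert_norm_eq: "H x = M x + M (- x)"
  by (simp add: hilbert_norm_def m_eq)

lemma thompson_norm_eq: "thompson_norm C e x = max (M x) (M (- x))"
  by (simp add: thompson_norm_def m_eq)

lemma sublinear_M: "sublinear M"
proof (rule sublinearI)
  have min: "M x *\<^sub>R e - x \<in> C" for x
    using M_le_iff by blast
  show add: "M (x + y) \<le> M x + M y" for x y
    using convex_cone_add[OF cone min[of x] min[of y]] by (simp add: M_le_iff algebra_simps)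
  show "M (a *\<^sub>R x) \<le> a * M x" if "0 < a" for a x
    using convex_cone_scaleR[OF cone _ min[of x], of a] that
    by (simp add: M_le_iff algebra_simps)
  show "M 0 = 0"
    using add[of 0 0] M_le_iff[of 0 0] convex_cone_contains_0[OF cone] by simp
qed

lemmas M_scale = sublinear_scale[OF sublinear_M]

lemma sublinear_H: "sublinear H"
  unfolding hilbert_norm_eq[abs_def]
  by (intro sublinear_sum sublinear_reflect sublinear_M)

lemmas H_scale = sublinear_scale[OF sublinear_H]

lemma H_nonneg: "0 \<le> H x"
  using sublinear_neg[OF sublinear_M, of x] by (simp add: hilbert_norm_eq)

lemma M_add_unit: "M (x + t *\<^sub>R e) = M x + t"
proof (rule antisym)
  show "M (x + t *\<^sub>R e) \<le> M x + t"
    using M_le_iff[of x "M x"] by (simp add: M_le_iff algebra_simps)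
  have "M (x + t *\<^sub>R e) *\<^sub>R e - (x + t *\<^sub>R e) \<in> C"
    using M_le_iff by blast
  then have "(M (x + t *\<^sub>R e) - t) *\<^sub>R e - x \<in> C"
    by (simp add: algebra_simps)
  then have "M x \<le> M (x + t *\<^sub>R e) - t"
    by (rule M_le_iff[THEN iffD2])
  then show "M x + t \<le> M (x + t *\<^sub>R e)" by simp
qed

lemma M_unit: "M (t *\<^sub>R e) = t"
  using M_add_unit[of 0 t] sublinear_zero[OF sublinear_M] by simp

lemma M_bound:
  obtains c where "0 < c" "\<And>x. M x \<le> c * norm x"
  using dominated_by_unit M_le_iff by metis

lemma mem_cone_iff: "x \<in> C \<longleftrightarrow> M (- x) \<le> 0"
  by (simp add: M_le_iff)

lemma mem_unit_interval_iff: "x \<in> cone_interval C 0 e \<longleftrightarrow> M (- x) \<le> 0 \<and> M x \<le> 1"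
  by (simp add: cone_interval_def cone_le_def M_le_iff)

lemma zero_mem_unit_interval: "0 \<in> cone_interval C 0 e"
  by (simp add: mem_unit_interval_iff sublinear_zero[OF sublinear_M])

lemma bounded_unit_interval:
  obtains b where "0 < b" "\<And>x. x \<in> cone_interval C 0 e \<Longrightarrow> norm x \<le> b"
proof -
  obtain K where K: "K > 0" "\<And>x y. cone_le C 0 x \<Longrightarrow> cone_le C x y \<Longrightarrow> norm x \<le> K * norm y"
    using normal unfolding normal_cone_def by blast
  show thesis
  proof (rule that[of "K * norm e + 1"])
    show "0 < K * norm e + 1"
      using K(1) by (intro add_nonneg_pos) auto
    show "norm x \<le> K * norm e + 1" if "x \<in> cone_interval C 0 e" for x
      using K(2)[of x e] that by (simp add: cone_interval_def)
  qed
qed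

text \<open>
  Modulo the line of \<open>e\<close>, the unit ball of Hilbert's seminorm is the order interval
  \<open>[0, e]\<close>. This is why the dual Hilbert norm is a supremum over \<open>[0, e]\<close>.
\<close>

lemma normalized_mem_unit_interval:
  assumes "0 < H x"
  shows "inverse (H x) *\<^sub>R (x + M (- x) *\<^sub>R e) \<in> cone_interval C 0 e"
proof -
  have "- (inverse (H x) *\<^sub>R (x + M (- x) *\<^sub>R e)) = inverse (H x) *\<^sub>R (- x + (- M (- x)) *\<^sub>R e)"
    by (simp add: scaleR_right_distrib scaleR_right_diff_distrib)
  then have "M (- (inverse (H x) *\<^sub>R (x + M (- x) *\<^sub>R e))) = 0"
    using assms M_scale[of "inverse (H x)" "- x + (- M (- x)) *\<^sub>R e"] M_add_unit[of "- x" "- M (- x)"]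
    by (simp only:) simp
  moreover have "M (inverse (H x) *\<^sub>R (x + M (- x) *\<^sub>R e)) = 1"
    using assms M_scale[of "inverse (H x)" "x + M (- x) *\<^sub>R e"] M_add_unit[of x "M (- x)"]
    by (simp add: hilbert_norm_eq[symmetric])
  ultimately show ?thesis
    by (simp add: mem_unit_interval_iff)
qed

lemma H_zero_imp_multiple:
  assumes "H x = 0"
  shows "x = M x *\<^sub>R e"
proof -
  have "M x *\<^sub>R e - x = 0"
  proof (rule eq_zero_if_both_signs)
    show "M x *\<^sub>R e - x \<in> C"
      using M_le_iff by blast
    have "M (- x) \<le> - M x"
      using assms by (simp add: hilbert_norm_eq)
    then show "- (M x *\<^sub>R e - x) \<in> C"
      by (simp add: M_le_iff)
  qed
  then show ?thesis by simp
qed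

lemma H_le_one: "x \<in> cone_interval C 0 e \<Longrightarrow> H x \<le> 1"
  by (simp add: mem_unit_interval_iff hilbert_norm_eq)

section \<open>Dual norms of functionals that annihilate the order unit\<close>

text \<open>The common value, on \<open>\<M>(e)\<close>, of the dual Hilbert norm and half the dual Thompson norm.\<close>

definition interval_sup :: "('a \<Rightarrow>\<^sub>L real) \<Rightarrow> real" where
  "interval_sup \<mu> = (SUP x\<in>cone_interval C 0 e. blinfun_apply \<mu> x)"

lemma interval_sup_upper:
  assumes "x \<in> cone_interval C 0 e"
  shows "blinfun_apply \<mu> x \<le> interval_sup \<mu>"
proof -
  obtain b where b: "0 < b" "\<And>x. x \<in> cone_interval C 0 e \<Longrightarrow> norm x \<le> b"
    using bounded_unit_interval by blast
  have "blinfun_apply \<mu> z \<le> norm \<mu> * b" if "z \<in> cone_interval C 0 e" for z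
    using norm_blinfun[of \<mu> z] mult_left_mono[OF b(2)[OF that], of "norm \<mu>"] by simp
  then show ?thesis
    unfolding interval_sup_def using assms by (intro cSUP_upper bdd_aboveI2)
qed

lemma interval_sup_least:
  assumes "\<And>x. x \<in> cone_interval C 0 e \<Longrightarrow> blinfun_apply \<mu> x \<le> b"
  shows "interval_sup \<mu> \<le> b"
  unfolding interval_sup_def using assms zero_mem_unit_interval by (intro cSUP_least) auto

lemma interval_sup_nonneg: "0 \<le> interval_sup \<mu>"
  using interval_sup_upper[OF zero_mem_unit_interval] by simp

lemma annihilator_le_interval_sup:
  assumes \<mu>: "\<mu> \<in> annihilator e"
  shows "\<bar>blinfun_apply \<mu> x\<bar> \<le> interval_sup \<mu> * H x"
proof -
  have e: "blinfun_apply \<mu> e = 0"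
    using \<mu> by (simp add: annihilator_def)
  have le: "blinfun_apply \<mu> x \<le> interval_sup \<mu> * H x" for x
  proof (cases "H x = 0")
    case True
    then have "blinfun_apply \<mu> x = 0"
      using H_zero_imp_multiple[OF True] e by (metis blinfun.scaleR_right scaleR_zero_right)
    with True show ?thesis by simp
  next
    case False
    then have pos: "0 < H x"
      using H_nonneg[of x] by simp
    from interval_sup_upper[OF normalized_mem_unit_interval[OF pos], of \<mu>]
    have "inverse (H x) * blinfun_apply \<mu> x \<le> interval_sup \<mu>"
      by (simp add: blinfun.add_right blinfun.scaleR_right e)
    then show ?thesis
      using pos by (simp add: field_simps)
  qed
  have "H (- x) = H x"
    by (simp add: hilbert_norm_eq)
  with le[of x] le[of "- x"] show ?thesis
    by (simp add: blinfun.minus_right)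
qed

lemma dual_hilbert_norm_eq_interval_sup:
  assumes \<mu>: "\<mu> \<in> annihilator e"
  shows "dual_hilbert_norm C e \<mu> = interval_sup \<mu>"
proof (rule antisym)
  have up: "z \<le> interval_sup \<mu>" if z: "z \<in> {\<bar>blinfun_apply \<mu> x\<bar> | x. H x = 1}" for z
  proof -
    obtain x where "z = \<bar>blinfun_apply \<mu> x\<bar>" "H x = 1"
      using z by blast
    then show ?thesis
      using annihilator_le_interval_sup[OF \<mu>, of x] by simp
  qed
  show "dual_hilbert_norm C e \<mu> \<le> interval_sup \<mu>"
    unfolding dual_hilbert_norm_def by (rule nnSup_least[OF up interval_sup_nonneg])
  have nonneg: "0 \<le> dual_hilbert_norm C e \<mu>"
    unfolding dual_hilbert_norm_def by (rule nnSup_nonneg[OF up])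
  show "interval_sup \<mu> \<le> dual_hilbert_norm C e \<mu>"
  proof (rule interval_sup_least)
    fix x
    assume x: "x \<in> cone_interval C 0 e"
    show "blinfun_apply \<mu> x \<le> dual_hilbert_norm C e \<mu>"
    proof (cases "H x = 0")
      case True
      then show ?thesis
        using annihilator_le_interval_sup[OF \<mu>, of x] nonneg by simp
    next
      case False
      then have pos: "0 < H x"
        using H_nonneg[of x] by simp
      have "H (inverse (H x) *\<^sub>R x) = 1"
        using pos by (simp add: H_scale)
      then have "\<bar>blinfun_apply \<mu> (inverse (H x) *\<^sub>R x)\<bar> \<le> dual_hilbert_norm C e \<mu>"
        unfolding dual_hilbert_norm_def by (intro nnSup_upper[OF _ up]) auto
      then have "\<bar>blinfun_apply \<mu> x\<bar> \<le> dual_hilbert_norm C e \<mu> * H x"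
        using pos by (simp add: blinfun.scaleR_right abs_mult field_simps)
      also have "\<dots> \<le> dual_hilbert_norm C e \<mu>"
        using nonneg H_le_one[OF x] by (simp add: mult_left_le)
      finally show ?thesis by simp
    qed
  qed
qed

text \<open>
  The affine map \<open>x \<mapsto> (x + e) / 2\<close> carries the unit ball \<open>[- e, e]\<close> of Thompson's norm
  onto \<open>[0, e]\<close>, which accounts for the factor two.
\<close>

lemma dual_thompson_norm_eq_interval_sup:
  assumes \<mu>: "\<mu> \<in> annihilator e"
  shows "dual_thompson_norm C e \<mu> = 2 * interval_sup \<mu>"
proof (rule antisym)
  have e: "blinfun_apply \<mu> e = 0"
    using \<mu> by (simp add: annihilator_def)
  define S where "S = {blinfun_apply \<mu> x | x. thompson_norm C e x = 1}"
  have "thompson_norm C e e = 1"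
    using M_unit[of 1] M_unit[of "- 1"] by (simp add: thompson_norm_eq)
  then have zero: "0 \<in> S"
    unfolding S_def using e by force
  have up: "z \<le> 2 * interval_sup \<mu>" if z: "z \<in> S" for z
  proof -
    obtain x where x: "z = blinfun_apply \<mu> x" and "max (M x) (M (- x)) = 1"
      using z unfolding S_def thompson_norm_eq by blast
    then have M: "M x \<le> 1" "M (- x) \<le> 1"
      by linarith+
    have "M ((1/2) *\<^sub>R (x + 1 *\<^sub>R e)) \<le> 1" "M ((1/2) *\<^sub>R (- x + (- 1) *\<^sub>R e)) \<le> 0"
      using M by (subst M_scale, simp, subst M_add_unit, simp)+
    then have "(1/2) *\<^sub>R (x + e) \<in> cone_interval C 0 e"
      by (simp add: mem_unit_interval_iff algebra_simps)
    from interval_sup_upper[OF this, of \<mu>] show ?thesis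
      by (simp add: x blinfun.add_right blinfun.scaleR_right e)
  qed
  show "dual_thompson_norm C e \<mu> \<le> 2 * interval_sup \<mu>"
    unfolding dual_thompson_norm_def S_def[symmetric] using zero up by (intro cSup_least) auto
  have Sup: "z \<le> dual_thompson_norm C e \<mu>" if "z \<in> S" for z
    unfolding dual_thompson_norm_def S_def[symmetric] using up that
    by (intro cSup_upper bdd_aboveI)
  have "interval_sup \<mu> \<le> dual_thompson_norm C e \<mu> / 2"
  proof (rule interval_sup_least)
    fix x
    assume x: "x \<in> cone_interval C 0 e"
    define z where "z = 2 *\<^sub>R x + (- 1) *\<^sub>R e"
    define r where "r = max (M z) (M (- z))"
    have \<mu>z: "blinfun_apply \<mu> z = 2 * blinfun_apply \<mu> x"
      by (simp add: z_def blinfun.diff_right blinfun.scaleR_right e)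
    have "M z = 2 * M x - 1"
      unfolding z_def by (subst M_add_unit) (simp add: M_scale)
    moreover have "M (- z) = 2 * M (- x) + 1"
      using M_add_unit[of "2 *\<^sub>R (- x)" 1] M_scale[of 2 "- x"] by (simp add: z_def)
    ultimately have r1: "r \<le> 1"
      using x by (simp add: r_def mem_unit_interval_iff)
    show "blinfun_apply \<mu> x \<le> dual_thompson_norm C e \<mu> / 2"
    proof (cases "0 < r")
      case True
      have "M (inverse r *\<^sub>R z) = inverse r * M z" "M (- (inverse r *\<^sub>R z)) = inverse r * M (- z)"
        using True M_scale[of "inverse r" z] M_scale[of "inverse r" "- z"] by simp_all
      then have "thompson_norm C e (inverse r *\<^sub>R z) = inverse r * r"
        using True unfolding thompson_norm_eq r_def by (auto simp: max_def)
      then have "thompson_norm C e (inverse r *\<^sub>R z) = 1"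
        using True by simp
      then have "blinfun_apply \<mu> (inverse r *\<^sub>R z) \<in> S"
        unfolding S_def by blast
      then have "inverse r * blinfun_apply \<mu> z \<le> dual_thompson_norm C e \<mu>"
        using Sup by (simp add: blinfun.scaleR_right)
      then have "blinfun_apply \<mu> z \<le> r * dual_thompson_norm C e \<mu>"
        using True by (simp add: field_simps)
      also have "\<dots> \<le> dual_thompson_norm C e \<mu>"
        using r1 Sup[OF zero] by (simp add: mult_left_le_one_le True less_imp_le)
      finally show ?thesis
        by (simp add: \<mu>z)
    next
      case False
      then have "z = 0"
        by (intro eq_zero_if_both_signs) (simp_all add: mem_cone_iff r_def max_def split: if_splits)
      then show ?thesis
        using \<mu>z Sup[OF zero] by (simp add: blinfun.zero_right)
    qed
  qed
  then show "2 * interval_sup \<mu> \<le> dual_thompson_norm C e \<mu>"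
    by simp
qed

section \<open>States\<close>

lemma states_iff: "\<nu> \<in> states C e \<longleftrightarrow> blinfun_apply \<nu> \<le> M"
proof
  assume \<nu>: "\<nu> \<in> states C e"
  show "blinfun_apply \<nu> \<le> M"
  proof (rule le_funI)
    fix x
    have "M x *\<^sub>R e - x \<in> C"
      using M_le_iff by blast
    then have "0 \<le> blinfun_apply \<nu> (M x *\<^sub>R e - x)"
      using \<nu> by (simp add: states_def dual_cone_def)
    then show "blinfun_apply \<nu> x \<le> M x"
      using \<nu> by (simp add: states_def blinfun.diff_right blinfun.scaleR_right)
  qed
next
  assume \<nu>: "blinfun_apply \<nu> \<le> M"
  have "0 \<le> blinfun_apply \<nu> x" if "x \<in> C" for x
    using that le_funD[OF \<nu>, of "- x"] by (simp add: mem_cone_iff blinfun.minus_right)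
  moreover have "blinfun_apply \<nu> e = 1"
    using le_funD[OF \<nu>, of e] le_funD[OF \<nu>, of "- e"] M_unit[of 1] M_unit[of "- 1"]
    by (simp add: blinfun.minus_right)
  ultimately show "\<nu> \<in> states C e"
    by (simp add: states_def dual_cone_def)
qed

lemma state_of_linear:
  assumes f: "linear f" "f \<le> M"
  obtains \<nu> where "\<nu> \<in> states C e" "blinfun_apply \<nu> = f"
proof -
  obtain c where c: "0 < c" "\<And>x. M x \<le> c * norm x"
    using M_bound by blast
  have "norm (f x) \<le> norm x * c" for x
    using le_funD[OF f(2), of x] le_funD[OF f(2), of "- x"] c(2)[of x] c(2)[of "- x"]
    by (simp add: linear_neg[OF f(1)] abs_le_iff mult.commute)
  then have "bounded_linear f"
    by (intro bounded_linear_intro) (simp_all add: linear_add linear_scale f(1))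
  then have "blinfun_apply (Blinfun f) = f"
    by (rule bounded_linear_Blinfun_apply)
  with f(2) show thesis
    by (intro that[of "Blinfun f"]) (simp_all add: states_iff)
qed

lemma state_difference:
  assumes "\<nu> \<in> states C e" "\<pi> \<in> states C e"
  shows "linear (\<lambda>x. blinfun_apply \<nu> x - blinfun_apply \<pi> x)"
    and "(\<lambda>x. blinfun_apply \<nu> x - blinfun_apply \<pi> x) \<le> H"
    and "\<nu> - \<pi> \<in> annihilator e"
    and "dual_hilbert_norm C e (\<nu> - \<pi>) \<le> 1"
proof -
  have lin: "linear (blinfun_apply \<rho>)" for \<rho> :: "'a \<Rightarrow>\<^sub>L real"
    by (rule bounded_linear.linear[OF blinfun.bounded_linear_right])
  show "linear (\<lambda>x. blinfun_apply \<nu> x - blinfun_apply \<pi> x)"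
    by (intro linear_compose_sub lin)
  have \<nu>: "blinfun_apply \<nu> x \<le> M x" and \<pi>: "- blinfun_apply \<pi> x \<le> M (- x)" for x
    using assms le_funD[of "blinfun_apply \<nu>" M x] le_funD[of "blinfun_apply \<pi>" M "- x"]
    by (simp_all add: states_iff blinfun.minus_right)
  show "(\<lambda>x. blinfun_apply \<nu> x - blinfun_apply \<pi> x) \<le> H"
  proof (rule le_funI)
    show "blinfun_apply \<nu> x - blinfun_apply \<pi> x \<le> H x" for x
      using \<nu>[of x] \<pi>[of x] by (simp add: hilbert_norm_eq)
  qed
  show ann: "\<nu> - \<pi> \<in> annihilator e"
    using assms by (simp add: states_def annihilator_def blinfun.diff_left)
  have "blinfun_apply (\<nu> - \<pi>) x \<le> 1" if "x \<in> cone_interval C 0 e" for x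
    using that \<nu>[of x] \<pi>[of x] by (simp add: mem_unit_interval_iff blinfun.diff_left)
  then show "dual_hilbert_norm C e (\<nu> - \<pi>) \<le> 1"
    unfolding dual_hilbert_norm_eq_interval_sup[OF ann] by (rule interval_sup_least)
qed

text \<open>
  The linear functionals below \<open>H\<close> are the differences of two states, because \<open>H\<close> is the
  sum of \<open>M\<close> and its reflection. If such a difference \<open>\<nu> - \<pi>\<close> is extreme, then so are
  \<open>\<nu>\<close> and \<open>\<pi>\<close>: a segment around one of them is translated to a segment around the
  difference. Disjointness comes from the same source: a state \<open>\<rho>\<close> above \<open>\<nu> / 2\<close> and
  \<open>\<pi> / 2\<close> is the midpoint of \<open>\<nu>, \<nu>'\<close> and of \<open>\<pi>, \<pi>'\<close> for states \<open>\<nu>', \<pi>'\<close>; then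
  \<open>\<nu> - \<pi>\<close> is the midpoint of \<open>\<nu> - \<nu>'\<close> and \<open>\<pi>' - \<pi>\<close>, which forces \<open>\<nu>' = \<pi>\<close>.
\<close>

theorem hilbert_norm_attained_at_disjoint_extreme_states:
  obtains \<nu> \<pi> where "\<nu> extreme_point_of states C e" "\<pi> extreme_point_of states C e"
    "disjoint_states C e \<nu> \<pi>" "blinfun_apply (\<nu> - \<pi>) y = H y"
proof -
  obtain f where f: "linear f" "f \<le> H" "f y = H y"
    and extreme: "\<And>g h u. linear g \<Longrightarrow> linear h \<Longrightarrow> g \<le> H \<Longrightarrow> h \<le> H \<Longrightarrow> 0 < u \<Longrightarrow> u < 1
       \<Longrightarrow> (\<And>x. f x = (1 - u) * g x + u * h x) \<Longrightarrow> g = f \<and> h = f"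
    using extreme_linear_functional_attaining[OF sublinear_H] by metis
  have "f x \<le> M x + M (- x)" for x
    using le_funD[OF f(2), of x] by (simp add: hilbert_norm_eq)
  then obtain g h where g: "linear g" "g \<le> M" and h: "linear h" "h \<le> (\<lambda>x. M (- x))"
    and fgh: "\<And>x. f x = g x + h x"
    using linear_functional_below_sum[OF sublinear_M sublinear_reflect[OF sublinear_M] f(1)]
    by metis
  have "linear (\<lambda>x. - h x)"
    using h(1) by (rule linear_compose_neg)
  moreover have "(\<lambda>x. - h x) \<le> M"
  proof (rule le_funI)
    show "- h x \<le> M x" for x
      using le_funD[OF h(2), of "- x"] by (simp add: linear_neg h(1))
  qed
  ultimately obtain \<pi> where \<pi>: "\<pi> \<in> states C e" "blinfun_apply \<pi> = (\<lambda>x. - h x)"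
    by (rule state_of_linear)
  obtain \<nu> where \<nu>: "\<nu> \<in> states C e" "blinfun_apply \<nu> = g"
    using g by (rule state_of_linear)
  have f_eq: "f x = blinfun_apply \<nu> x - blinfun_apply \<pi> x" for x
    by (simp add: fgh \<nu> \<pi>)
  have split: "blinfun_apply \<alpha> x - blinfun_apply \<beta> x = f x"
    if states: "\<alpha> \<in> states C e" "\<beta> \<in> states C e" "\<gamma> \<in> states C e" "\<delta> \<in> states C e"
      and u: "0 < u" "u < 1"
      and comb: "\<And>x. f x = (1 - u) * (blinfun_apply \<alpha> x - blinfun_apply \<beta> x)
                          + u * (blinfun_apply \<gamma> x - blinfun_apply \<delta> x)"
    for \<alpha> \<beta> \<gamma> \<delta> u x
  proof -
    have "(\<lambda>x. blinfun_apply \<alpha> x - blinfun_apply \<beta> x) = f"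
      using extreme[OF state_difference(1)[OF states(1,2)] state_difference(1)[OF states(3,4)]
          state_difference(2)[OF states(1,2)] state_difference(2)[OF states(3,4)] u comb]
      by blast
    then show ?thesis by (rule fun_cong)
  qed
  have "\<nu> extreme_point_of states C e"
    unfolding extreme_point_of_def
  proof (intro conjI ballI notI \<nu>(1))
    fix \<alpha> \<gamma>
    assume \<alpha>: "\<alpha> \<in> states C e" and \<gamma>: "\<gamma> \<in> states C e" and "\<nu> \<in> open_segment \<alpha> \<gamma>"
    then obtain u where "\<alpha> \<noteq> \<gamma>" and u: "0 < u" "u < 1" "\<nu> = (1 - u) *\<^sub>R \<alpha> + u *\<^sub>R \<gamma>"
      unfolding in_segment by blast
    have comb: "blinfun_apply \<nu> x = (1 - u) * blinfun_apply \<alpha> x + u * blinfun_apply \<gamma> x" for x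
      by (simp add: u(3) blinfun.add_left blinfun.scaleR_left)
    have "blinfun_apply \<alpha> x - blinfun_apply \<pi> x = f x" for x
      by (rule split[OF \<alpha> \<pi>(1) \<gamma> \<pi>(1) u(1,2)])
        (simp add: f_eq comb algebra_simps)
    then have "\<alpha> = \<nu>"
      by (intro blinfun_eqI) (simp add: f_eq)
    with u(3) have "u *\<^sub>R \<gamma> = u *\<^sub>R \<alpha>"
      by (simp add: scaleR_diff_left)
    with u(1) \<open>\<alpha> \<noteq> \<gamma>\<close> show False by simp
  qed
  moreover have "\<pi> extreme_point_of states C e"
    unfolding extreme_point_of_def
  proof (intro conjI ballI notI \<pi>(1))
    fix \<beta> \<delta>
    assume \<beta>: "\<beta> \<in> states C e" and \<delta>: "\<delta> \<in> states C e" and "\<pi> \<in> open_segment \<beta> \<delta>"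
    then obtain u where "\<beta> \<noteq> \<delta>" and u: "0 < u" "u < 1" "\<pi> = (1 - u) *\<^sub>R \<beta> + u *\<^sub>R \<delta>"
      unfolding in_segment by blast
    have comb: "blinfun_apply \<pi> x = (1 - u) * blinfun_apply \<beta> x + u * blinfun_apply \<delta> x" for x
      by (simp add: u(3) blinfun.add_left blinfun.scaleR_left)
    have "blinfun_apply \<nu> x - blinfun_apply \<beta> x = f x" for x
      by (rule split[OF \<nu>(1) \<beta> \<nu>(1) \<delta> u(1,2)])
        (simp add: f_eq comb algebra_simps)
    then have "\<beta> = \<pi>"
      by (intro blinfun_eqI) (simp add: f_eq)
    with u(3) have "u *\<^sub>R \<delta> = u *\<^sub>R \<beta>"
      by (simp add: scaleR_diff_left)
    with u(1) \<open>\<beta> \<noteq> \<delta>\<close> show False by simp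
  qed
  moreover have "disjoint_states C e \<nu> \<pi>"
    unfolding disjoint_states_def
  proof (intro ballI impI)
    fix \<rho>
    assume \<rho>: "\<rho> \<in> states C e"
      and above: "cone_le (dual_cone C) ((1/2) *\<^sub>R \<nu>) \<rho> \<and> cone_le (dual_cone C) ((1/2) *\<^sub>R \<pi>) \<rho>"
    have reflected: "2 *\<^sub>R \<rho> - \<sigma> \<in> states C e"
      if "\<sigma> \<in> states C e" "cone_le (dual_cone C) ((1/2) *\<^sub>R \<sigma>) \<rho>" for \<sigma>
      using that \<rho> by (auto simp: states_def dual_cone_def cone_le_def blinfun.diff_left
          blinfun.scaleR_left)
    have "blinfun_apply \<nu> x - blinfun_apply (2 *\<^sub>R \<rho> - \<nu>) x = f x" for x
      using reflected[OF \<nu>(1)] reflected[OF \<pi>(1)] above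
      by (intro split[where \<gamma> = "2 *\<^sub>R \<rho> - \<pi>" and \<delta> = \<pi> and u = "1/2"] \<nu>(1) \<pi>(1))
        (simp_all add: f_eq blinfun.diff_left blinfun.scaleR_left field_simps)
    then have "blinfun_apply \<rho> x = (blinfun_apply \<nu> x + blinfun_apply \<pi> x) / 2" for x
      by (simp add: f_eq blinfun.diff_left blinfun.scaleR_left) (smt (verit) field_sum_of_halves)
    then show "\<rho> = (1/2) *\<^sub>R (\<nu> + \<pi>)"
      by (intro blinfun_eqI) (simp add: blinfun.add_left blinfun.scaleR_left)
  qed
  moreover have "blinfun_apply (\<nu> - \<pi>) y = H y"
    using f(3) f_eq by (simp add: blinfun.diff_left)
  ultimately show thesis
    by (rule that)
qed

end

section \<open>The operator norm\<close>

theorem theorem5p1: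
  fixes C\<^sub>1 :: "'a::banach set" and e\<^sub>1 :: 'a
    and C\<^sub>2 :: "'b::banach set" and e\<^sub>2 :: 'b
    and T :: "'a \<Rightarrow>\<^sub>L 'b"
  assumes "(UNIV :: 'a set) \<noteq> {0}" and "(UNIV :: 'b set) \<noteq> {0}"
    and "convex_cone C\<^sub>1" and "closed C\<^sub>1" and "pointed_cone C\<^sub>1" and "normal_cone C\<^sub>1"
    and "e\<^sub>1 \<in> interior C\<^sub>1"
    and "convex_cone C\<^sub>2" and "closed C\<^sub>2" and "pointed_cone C\<^sub>2" and "normal_cone C\<^sub>2"
    and "e\<^sub>2 \<in> interior C\<^sub>2"
    and "\<exists>c. blinfun_apply T e\<^sub>1 = c *\<^sub>R e\<^sub>2"
  shows
    "(hilbert_op_norm C\<^sub>1 e\<^sub>1 C\<^sub>2 e\<^sub>2 T = dual_hilbert_op_norm C\<^sub>1 e\<^sub>1 C\<^sub>2 e\<^sub>2 (adjoint_blinfun T)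
      \<and> dual_hilbert_op_norm C\<^sub>1 e\<^sub>1 C\<^sub>2 e\<^sub>2 (adjoint_blinfun T) =
          1/2 * nnSup {dual_thompson_norm C\<^sub>1 e\<^sub>1 (adjoint_blinfun T \<nu> - adjoint_blinfun T \<pi>) | \<nu> \<pi>.
                         \<nu> \<in> states C\<^sub>2 e\<^sub>2 \<and> \<pi> \<in> states C\<^sub>2 e\<^sub>2}
      \<and> dual_hilbert_op_norm C\<^sub>1 e\<^sub>1 C\<^sub>2 e\<^sub>2 (adjoint_blinfun T) =
          nnSup {(SUP x\<in>cone_interval C\<^sub>1 0 e\<^sub>1. blinfun_apply (\<nu> - \<pi>) (blinfun_apply T x)) | \<nu> \<pi>.
                   \<nu> \<in> states C\<^sub>2 e\<^sub>2 \<and> \<pi> \<in> states C\<^sub>2 e\<^sub>2})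
     \<and>
     (hilbert_op_norm C\<^sub>1 e\<^sub>1 C\<^sub>2 e\<^sub>2 T = dual_hilbert_op_norm C\<^sub>1 e\<^sub>1 C\<^sub>2 e\<^sub>2 (adjoint_blinfun T)
      \<and> dual_hilbert_op_norm C\<^sub>1 e\<^sub>1 C\<^sub>2 e\<^sub>2 (adjoint_blinfun T) =
          1/2 * nnSup {dual_thompson_norm C\<^sub>1 e\<^sub>1 (adjoint_blinfun T \<nu> - adjoint_blinfun T \<pi>) | \<nu> \<pi>.
                         \<nu> extreme_point_of states C\<^sub>2 e\<^sub>2 \<and> \<pi> extreme_point_of states C\<^sub>2 e\<^sub>2
                         \<and> disjoint_states C\<^sub>2 e\<^sub>2 \<nu> \<pi>}
      \<and> dual_hilbert_op_norm C\<^sub>1 e\<^sub>1 C\<^sub>2 e\<^sub>2 (adjoint_blinfun T) =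
          nnSup {(SUP x\<in>cone_interval C\<^sub>1 0 e\<^sub>1. blinfun_apply (\<nu> - \<pi>) (blinfun_apply T x)) | \<nu> \<pi>.
                   \<nu> extreme_point_of states C\<^sub>2 e\<^sub>2 \<and> \<pi> extreme_point_of states C\<^sub>2 e\<^sub>2
                   \<and> disjoint_states C\<^sub>2 e\<^sub>2 \<nu> \<pi>})"
proof -
  interpret c1: order_unit_cone C\<^sub>1 e\<^sub>1
    by unfold_locales (fact assms)+
  interpret c2: order_unit_cone C\<^sub>2 e\<^sub>2
    by unfold_locales (fact assms)+
  obtain c where Te: "blinfun_apply T e\<^sub>1 = c *\<^sub>R e\<^sub>2"
    using assms(13) by blast
  let ?T' = "adjoint_blinfun T"
  let ?I = "cone_interval C\<^sub>1 0 e\<^sub>1"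
  let ?A = "{c2.H (blinfun_apply T x) | x. c1.H x = 1}"
  let ?D = "{dual_hilbert_norm C\<^sub>1 e\<^sub>1 (?T' \<mu>) | \<mu>.
              \<mu> \<in> annihilator e\<^sub>2 \<and> dual_hilbert_norm C\<^sub>2 e\<^sub>2 \<mu> \<le> 1}"
  define R where "R = (\<lambda>\<nu> \<pi>. \<nu> extreme_point_of states C\<^sub>2 e\<^sub>2 \<and> \<pi> extreme_point_of states C\<^sub>2 e\<^sub>2
                   \<and> disjoint_states C\<^sub>2 e\<^sub>2 \<nu> \<pi>)"
  define A where "A = hilbert_op_norm C\<^sub>1 e\<^sub>1 C\<^sub>2 e\<^sub>2 T"
  define D where "D = dual_hilbert_op_norm C\<^sub>1 e\<^sub>1 C\<^sub>2 e\<^sub>2 ?T'"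
  have A: "A = nnSup ?A" and D: "D = nnSup ?D"
    by (simp_all add: A_def D_def hilbert_op_norm_def dual_hilbert_op_norm_def)
  have T'_apply: "blinfun_apply (?T' \<mu>) x = blinfun_apply \<mu> (blinfun_apply T x)" for \<mu> x
    by (simp add: adjoint_blinfun_def)
  have T'_ann: "?T' \<mu> \<in> annihilator e\<^sub>1" if "\<mu> \<in> annihilator e\<^sub>2" for \<mu>
    using that by (simp add: annihilator_def T'_apply Te blinfun.scaleR_right)
  have shift: "blinfun_apply \<mu> (blinfun_apply T (a *\<^sub>R (x + t *\<^sub>R e\<^sub>1))) = a * blinfun_apply \<mu> (blinfun_apply T x)"
    if "\<mu> \<in> annihilator e\<^sub>2" for \<mu> a x t
    using that by (simp add: annihilator_def blinfun.add_right blinfun.scaleR_right Te)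

  \<comment> \<open>Shifting along \<open>e\<^sub>1\<close> moves a vector of Hilbert seminorm one into \<open>[0, e\<^sub>1]\<close>, which is
    bounded in norm because \<open>C\<^sub>1\<close> is normal. A difference of states annihilates
    \<open>T e\<^sub>1\<close>, a multiple of \<open>e\<^sub>2\<close>, so the shift does not change its value at the image.\<close>
  have attained: "\<exists>\<nu> \<pi>. R \<nu> \<pi> \<and> (\<exists>z\<in>?I. blinfun_apply (\<nu> - \<pi>) (blinfun_apply T z) = c2.H (blinfun_apply T x))"
    if "c1.H x = 1" for x
  proof -
    obtain \<nu> \<pi> where \<nu>\<pi>: "R \<nu> \<pi>" "blinfun_apply (\<nu> - \<pi>) (blinfun_apply T x) = c2.H (blinfun_apply T x)"
      using c2.hilbert_norm_attained_at_disjoint_extreme_states unfolding R_def by metis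
    then have "\<nu> - \<pi> \<in> annihilator e\<^sub>2"
      by (intro c2.state_difference) (simp_all add: R_def extreme_point_of_def)
    from shift[OF this, of 1 x "c1.M (- x)"] have
      "blinfun_apply (\<nu> - \<pi>) (blinfun_apply T (x + c1.M (- x) *\<^sub>R e\<^sub>1)) = c2.H (blinfun_apply T x)"
      by (simp add: \<nu>\<pi>)
    moreover have "x + c1.M (- x) *\<^sub>R e\<^sub>1 \<in> ?I"
      using c1.normalized_mem_unit_interval[of x] that by simp
    ultimately show ?thesis
      using \<nu>\<pi>(1) by blast
  qed
  have R_states: "\<nu> \<in> states C\<^sub>2 e\<^sub>2" "\<pi> \<in> states C\<^sub>2 e\<^sub>2" if "R \<nu> \<pi>" for \<nu> \<pi>
    using that by (simp_all add: R_def extreme_point_of_def)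
  obtain b where b: "\<And>a. a \<in> ?A \<Longrightarrow> a \<le> b"
  proof -
    obtain k where k: "0 < k" "\<And>y. c2.M y \<le> k * norm y"
      using c2.M_bound by blast
    obtain r where r: "\<And>z. z \<in> ?I \<Longrightarrow> norm z \<le> r"
      using c1.bounded_unit_interval by blast
    have "a \<le> 2 * k * (norm T * r)" if a: "a \<in> ?A" for a
    proof -
      obtain x where "a = c2.H (blinfun_apply T x)" "c1.H x = 1"
        using a by blast
      with attained obtain \<nu> \<pi> z where "R \<nu> \<pi>" "z \<in> ?I"
        "blinfun_apply (\<nu> - \<pi>) (blinfun_apply T z) = a"
        by blast
      then have "a \<le> c2.H (blinfun_apply T z)"
        using le_funD[OF c2.state_difference(2)[OF R_states[of \<nu> \<pi>]], of "blinfun_apply T z"]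
        by (simp add: blinfun.diff_left)
      also have "\<dots> \<le> 2 * k * norm (blinfun_apply T z)"
        using k(2)[of "blinfun_apply T z"] k(2)[of "- blinfun_apply T z"]
        by (simp add: c2.hilbert_norm_eq)
      also have "\<dots> \<le> 2 * k * (norm T * r)"
        using norm_blinfun[of T z] mult_left_mono[OF r[OF \<open>z \<in> ?I\<close>], of "norm T"] k(1)
        by (intro mult_left_mono) auto
      finally show ?thesis .
    qed
    then show thesis by (rule that)
  qed
  have A_nonneg: "0 \<le> A"
    unfolding A by (rule nnSup_nonneg[OF b])

  have DA: "d \<le> A" if "d \<in> ?D" for d
  proof -
    obtain \<mu> where \<mu>: "d = dual_hilbert_norm C\<^sub>1 e\<^sub>1 (?T' \<mu>)" "\<mu> \<in> annihilator e\<^sub>2"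
      "dual_hilbert_norm C\<^sub>2 e\<^sub>2 \<mu> \<le> 1"
      using \<open>d \<in> ?D\<close> by blast
    show ?thesis
      unfolding \<mu>(1) dual_hilbert_norm_def
    proof (rule nnSup_least[OF _ A_nonneg])
      fix w
      assume "w \<in> {\<bar>blinfun_apply (?T' \<mu>) x\<bar> | x. c1.H x = 1}"
      then obtain x where x: "w = \<bar>blinfun_apply \<mu> (blinfun_apply T x)\<bar>" "c1.H x = 1"
        by (auto simp: T'_apply)
      have "w \<le> c2.interval_sup \<mu> * c2.H (blinfun_apply T x)"
        unfolding x(1) by (rule c2.annihilator_le_interval_sup[OF \<mu>(2)])
      also have "\<dots> \<le> c2.H (blinfun_apply T x)"
        using \<mu>(3) c2.H_nonneg[of "blinfun_apply T x"] c2.interval_sup_nonneg[of \<mu>]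
        by (simp add: c2.dual_hilbert_norm_eq_interval_sup[OF \<mu>(2)] mult_left_le_one_le)
      also have "\<dots> \<le> A"
        unfolding A using x(2) by (intro nnSup_upper[OF _ b]) auto
      finally show "w \<le> A" .
    qed
  qed
  have D_le_A: "D \<le> A"
    unfolding D by (rule nnSup_least[OF DA A_nonneg])
  have D_nonneg: "0 \<le> D"
    unfolding D by (rule nnSup_nonneg[OF DA])

  \<comment> \<open>A family of pairs of states gives at most \<open>D\<close>, and the disjoint extreme pairs alone
    give at least \<open>A\<close>; so one argument serves every family in between.\<close>
  have family: "D = 1/2 * nnSup {dual_thompson_norm C\<^sub>1 e\<^sub>1 (?T' \<nu> - ?T' \<pi>) | \<nu> \<pi>. P \<nu> \<pi>}"
      "D = nnSup {(SUP x\<in>?I. blinfun_apply (\<nu> - \<pi>) (blinfun_apply T x)) | \<nu> \<pi>. P \<nu> \<pi>}"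
      "D = A"
    if P: "\<And>\<nu> \<pi>. P \<nu> \<pi> \<Longrightarrow> \<nu> \<in> states C\<^sub>2 e\<^sub>2 \<and> \<pi> \<in> states C\<^sub>2 e\<^sub>2"
      and RP: "\<And>\<nu> \<pi>. R \<nu> \<pi> \<Longrightarrow> P \<nu> \<pi>" for P
  proof -
    let ?F = "{c1.interval_sup (?T' (\<nu> - \<pi>)) | \<nu> \<pi>. P \<nu> \<pi>}"
    have interval_sup: "c1.interval_sup (?T' \<mu>) = (SUP x\<in>?I. blinfun_apply \<mu> (blinfun_apply T x))" for \<mu>
      by (simp add: c1.interval_sup_def T'_apply)
    have ann: "?T' (\<nu> - \<pi>) \<in> annihilator e\<^sub>1" if "P \<nu> \<pi>" for \<nu> \<pi>
      using P[OF that] by (intro T'_ann c2.state_difference) auto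
    have FD: "v \<le> D" if v: "v \<in> ?F" for v
    proof -
      obtain \<nu> \<pi> where \<nu>\<pi>: "v = c1.interval_sup (?T' (\<nu> - \<pi>))" "P \<nu> \<pi>"
        using v by blast
      then have "v \<in> ?D"
        using c2.state_difference(3,4) P[OF \<nu>\<pi>(2)] c1.dual_hilbert_norm_eq_interval_sup[OF ann[OF \<nu>\<pi>(2)]]
        by (intro CollectI exI[of _ "\<nu> - \<pi>"]) auto
      then show ?thesis
        unfolding D by (rule nnSup_upper[OF _ DA])
    qed
    have "nnSup ?F \<le> D"
      by (rule nnSup_least[OF FD D_nonneg])
    moreover have "A \<le> nnSup ?F"
      unfolding A
    proof (rule nnSup_least)
      fix a
      assume "a \<in> ?A"
      then obtain x where "a = c2.H (blinfun_apply T x)" "c1.H x = 1"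
        by blast
      with attained obtain \<nu> \<pi> z where z: "R \<nu> \<pi>" "z \<in> ?I"
        "blinfun_apply (\<nu> - \<pi>) (blinfun_apply T z) = a"
        by blast
      have "a \<le> c1.interval_sup (?T' (\<nu> - \<pi>))"
        using c1.interval_sup_upper[OF z(2), of "?T' (\<nu> - \<pi>)"] z(3) by (simp add: T'_apply)
      also have "\<dots> \<le> nnSup ?F"
        using RP[OF z(1)] by (intro nnSup_upper[OF _ FD]) auto
      finally show "a \<le> nnSup ?F" .
    next
      show "0 \<le> nnSup ?F"
        by (rule nnSup_nonneg[OF FD])
    qed
    ultimately have eq: "D = A" "D = nnSup ?F"
      using D_le_A by linarith+
    show "D = A"
      by (rule eq)
    show "D = nnSup {(SUP x\<in>?I. blinfun_apply (\<nu> - \<pi>) (blinfun_apply T x)) | \<nu> \<pi>. P \<nu> \<pi>}"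
      using eq(2) by (simp only: interval_sup)
    have diff: "?T' \<nu> - ?T' \<pi> = ?T' (\<nu> - \<pi>)" for \<nu> \<pi>
      by (rule blinfun_eqI) (simp add: T'_apply blinfun.diff_left)
    have thompson: "dual_thompson_norm C\<^sub>1 e\<^sub>1 (?T' \<nu> - ?T' \<pi>) = 2 * c1.interval_sup (?T' (\<nu> - \<pi>))"
      if "P \<nu> \<pi>" for \<nu> \<pi>
      unfolding diff using ann[OF that] by (rule c1.dual_thompson_norm_eq_interval_sup)
    have "{dual_thompson_norm C\<^sub>1 e\<^sub>1 (?T' \<nu> - ?T' \<pi>) | \<nu> \<pi>. P \<nu> \<pi>}
        = {2 * c1.interval_sup (?T' (\<nu> - \<pi>)) | \<nu> \<pi>. P \<nu> \<pi>}"
      by (intro Collect_cong) (metis thompson)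
    also have "\<dots> = (\<lambda>v. 2 * v) ` ?F"
      by blast
    also have "nnSup \<dots> = 2 * nnSup ?F"
      by (rule nnSup_scale[OF _ FD]) simp
    finally show "D = 1/2 * nnSup {dual_thompson_norm C\<^sub>1 e\<^sub>1 (?T' \<nu> - ?T' \<pi>) | \<nu> \<pi>. P \<nu> \<pi>}"
      using eq(2) by simp
  qed
  have R_le: "\<nu> \<in> states C\<^sub>2 e\<^sub>2 \<and> \<pi> \<in> states C\<^sub>2 e\<^sub>2" if "R \<nu> \<pi>" for \<nu> \<pi>
    using R_states[OF that] by blast
  note all = family[where P = "\<lambda>\<nu> \<pi>. \<nu> \<in> states C\<^sub>2 e\<^sub>2 \<and> \<pi> \<in> states C\<^sub>2 e\<^sub>2", OF _ R_le]
    and disjoint = family[where P = R, OF R_le]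
  show ?thesis
    unfolding A_def[symmetric] D_def[symmetric]
    using all disjoint unfolding R_def by (intro conjI) simp_all
qed

end
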